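(* Let $\Omega\subset\mathbb{R}$ be a bounded interval with a mesh $\mathcal{K}_{\mathcal{T}}$ consisting of finitely many closed intervals, let $p\ge 1$ be an integer, and let $S$ be the space of continuous functions on $\Omega$ whose restriction to each $K\in\mathcal{K}_{\mathcal{T}}$ is a polynomial of degree at most $p$. Then, for every $k\in\mathbb{R}\setminus\{0\}$, the system matrix $\mathbf{A}_k$ of the conforming Galerkin finite element discretization in $S$ of the Helmholtz problem with Robin boundary conditions is regular (invertible).
   Context: Let $\Omega\subset\mathbb{R}$ be a bounded interval with boundary $\Gamma=\partial\Omega$ (its two endpoints). $(u,v)=\int_\Omega u\overline{v}$ denotes the $L^2(\Omega)$ scalar product (complex-valued functions, conjugation on the second argument) and $\langle u,v\rangle_\Gamma$ the scalar product on $\Gamma$, i.e. here the sum of $u\overline{v}$ over the two endpoints. For $k\in\mathbb{R}\setminus\{0\}$ the Helmholtz sesquilinear form with Robin boundary conditions is $$a_k(u,v)=(u',v')-k^2(u,v)-\mathrm{i}k\langle u,v\rangle_\Gamma .$$ The mesh intervals cover $\overline\Omega$ and have pairwise disjoint interiors; mesh sizes are arbitrary. The Galerkin discretization is: given $F$, find $u_S\in S$ with $a_k(u_S,v)=F(v)$ for all $v\in S$. Let $\Sigma$ be the set of global nodal points (images, under the affine maps onto the mesh intervals, of a set of nodal points in the reference interval that is unisolvent for polynomials of degree at most $p$ and allows continuity to be imposed across mesh points) and $(b_z)_{z\in\Sigma}\subset S$ the associated Lagrange basis of $S$. The system matrix is $\mathbf{A}_k=\mathbf{K}-k^2\mathbf{M}-\mathrm{i}k\mathbf{B}$,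 with entries indexed by $y,z\in\Sigma$: $\mathbf{K}_{y,z}=(b_z',b_y')$, $\mathbf{M}_{y,z}=(b_z,b_y)$, $\mathbf{B}_{y,z}=\langle b_z,b_y\rangle_\Gamma$. *)

theory Defs
  imports "HOL-Analysis.Analysis" "Jordan_Normal_Form.Matrix"
begin

text \<open>
  \<open>\<Omega>\<close> is the bounded open interval \<open>{a<..<b}\<close>.  Functions on \<open>\<Omega>\<close> are represented by total
  functions \<open>real \<Rightarrow> complex\<close>, whose values outside \<open>{a..b}\<close> never matter.
\<close>

definition is_mesh :: "real \<Rightarrow> real \<Rightarrow> real set set \<Rightarrow> bool" where
  "is_mesh a b \<T> \<longleftrightarrow> \<T> division_of {a..b} \<and> (\<forall>K\<in>\<T>. interior K \<noteq> {})"

definition fe_space :: "real \<Rightarrow> real \<Rightarrow> real set set \<Rightarrow> nat \<Rightarrow> (real \<Rightarrow> complex) set" where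
  "fe_space a b \<T> p =
    {u. continuous_on {a..b} u \<and>
        (\<forall>K\<in>\<T>. \<exists>q :: complex poly. degree q \<le> p \<and> (\<forall>x\<in>K. u x = poly q (of_real x)))}"

definition unisolvent :: "nat \<Rightarrow> real set \<Rightarrow> bool" where
  "unisolvent p N \<longleftrightarrow>
    (\<forall>f :: real \<Rightarrow> complex. \<exists>!q :: complex poly.
        degree q \<le> p \<and> (\<forall>x\<in>N. poly q (of_real x) = f x))"

text \<open>
  The reference interval is \<open>{0..1}\<close>.  Continuity across mesh points can be imposed through nodal
  values exactly if the end points of the reference interval are nodal points.
\<close>

definition reference_nodes :: "nat \<Rightarrow> real set \<Rightarrow> bool" where
  "reference_nodes p N \<longleftrightarrow> N \<subseteq> {0..1} \<and> unisolvent p N \<and> 0 \<in> N \<and> 1 \<in> N"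

text \<open>The affine element maps may preserve or reverse the orientation, independently on each
  element.\<close>

definition element_maps :: "real set set \<Rightarrow> (real set \<Rightarrow> real \<Rightarrow> real) \<Rightarrow> bool" where
  "element_maps \<T> F \<longleftrightarrow>
    (\<forall>K\<in>\<T>. (\<exists>m c. \<forall>t. F K t = m * t + c) \<and> F K ` {0..1} = K)"

definition nodal_points ::
    "real set set \<Rightarrow> (real set \<Rightarrow> real \<Rightarrow> real) \<Rightarrow> real set \<Rightarrow> real set" where
  "nodal_points \<T> F N = (\<Union>K\<in>\<T>. F K ` N)"

text \<open>
  For the nodal points of a mesh these two conditions determine each \<open>\<phi> z\<close> on \<open>{a..b}\<close>, by
  unisolvence on every element, and the \<open>\<phi> z\<close> then form a basis of the finite element space.
\<close>

definition lagrange_basis ::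
    "(real \<Rightarrow> complex) set \<Rightarrow> real set \<Rightarrow> (real \<Rightarrow> real \<Rightarrow> complex) \<Rightarrow> bool" where
  "lagrange_basis S \<Sigma> \<phi> \<longleftrightarrow>
    (\<forall>z\<in>\<Sigma>. \<phi> z \<in> S \<and> (\<forall>y\<in>\<Sigma>. \<phi> z y = (if y = z then 1 else 0)))"

definition l2_prod :: "real \<Rightarrow> real \<Rightarrow> (real \<Rightarrow> complex) \<Rightarrow> (real \<Rightarrow> complex) \<Rightarrow> complex" where
  "l2_prod a b u v = (LINT x:{a<..<b}|lborel. u x * cnj (v x))"

definition bdry_prod :: "real \<Rightarrow> real \<Rightarrow> (real \<Rightarrow> complex) \<Rightarrow> (real \<Rightarrow> complex) \<Rightarrow> complex" where
  "bdry_prod a b u v = u a * cnj (v a) + u b * cnj (v b)"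

text \<open>
  For continuous piecewise polynomials the weak derivative is the pointwise one, which exists off
  the finitely many mesh points; the unspecified values of \<open>vector_derivative\<close> at the mesh points
  do not affect the integral.
\<close>

definition deriv_fun :: "(real \<Rightarrow> complex) \<Rightarrow> real \<Rightarrow> complex" where
  "deriv_fun u = (\<lambda>x. vector_derivative u (at x))"

definition helmholtz_form ::
    "real \<Rightarrow> real \<Rightarrow> real \<Rightarrow> (real \<Rightarrow> complex) \<Rightarrow> (real \<Rightarrow> complex) \<Rightarrow> complex" where
  "helmholtz_form a b k u v =
    l2_prod a b (deriv_fun u) (deriv_fun v) - (of_real k)\<^sup>2 * l2_prod a b u v
      - \<i> * of_real k * bdry_prod a b u v"

text \<open>
  The list \<open>zs\<close> enumerates the nodal points.  The column index belongs to the first, linear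
  argument (trial functions) and the row index to the second, conjugated one (test functions).
\<close>

definition gram_matrix ::
    "((real \<Rightarrow> complex) \<Rightarrow> (real \<Rightarrow> complex) \<Rightarrow> complex) \<Rightarrow> (real \<Rightarrow> real \<Rightarrow> complex) \<Rightarrow>
      real list \<Rightarrow> complex mat" where
  "gram_matrix s \<phi> zs = mat (length zs) (length zs) (\<lambda>(i, j). s (\<phi> (zs ! j)) (\<phi> (zs ! i)))"

definition stiffness_matrix ::
    "real \<Rightarrow> real \<Rightarrow> (real \<Rightarrow> real \<Rightarrow> complex) \<Rightarrow> real list \<Rightarrow> complex mat" where
  "stiffness_matrix a b = gram_matrix (\<lambda>u v. l2_prod a b (deriv_fun u) (deriv_fun v))"

definition mass_matrix ::
    "real \<Rightarrow> real \<Rightarrow> (real \<Rightarrow> real \<Rightarrow> complex) \<Rightarrow> real list \<Rightarrow> complex mat" where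
  "mass_matrix a b = gram_matrix (l2_prod a b)"

definition boundary_matrix ::
    "real \<Rightarrow> real \<Rightarrow> (real \<Rightarrow> real \<Rightarrow> complex) \<Rightarrow> real list \<Rightarrow> complex mat" where
  "boundary_matrix a b = gram_matrix (bdry_prod a b)"

definition system_matrix ::
    "real \<Rightarrow> real \<Rightarrow> real \<Rightarrow> (real \<Rightarrow> real \<Rightarrow> complex) \<Rightarrow> real list \<Rightarrow> complex mat" where
  "system_matrix a b k \<phi> zs =
    stiffness_matrix a b \<phi> zs - (of_real k)\<^sup>2 \<cdot>\<^sub>m mass_matrix a b \<phi> zs
      - (\<i> * of_real k) \<cdot>\<^sub>m boundary_matrix a b \<phi> zs"

lemma system_matrix_eq_gram_helmholtz_form:
  "system_matrix a b k \<phi> zs = gram_matrix (helmholtz_form a b k) \<phi> zs"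
  by (rule eq_matI)
    (auto simp: system_matrix_def stiffness_matrix_def mass_matrix_def boundary_matrix_def
      gram_matrix_def helmholtz_form_def)

end

theory Submission
  imports Defs "Jordan_Normal_Form.Determinant"
begin

text \<open>
  The system matrix is square, so it suffices to show that its kernel is trivial, that is, that
  a finite element function \<open>u\<close> with \<open>a\<^sub>k(u, v) = 0\<close> for all finite element functions \<open>v\<close> is zero.

  Testing with \<open>v = u\<close> and taking the imaginary part gives \<open>k (|u(a)|\<^sup>2 + |u(b)|\<^sup>2) = 0\<close>, so \<open>u\<close>
  vanishes at both end points (\<open>helmholtz_form_kernel_boundary\<close>).  On the continuous level,
  unique continuation would now give \<open>u = 0\<close>.  The discrete substitute proceeds through the
  elements from left to right.  Suppose that \<open>u\<close> vanishes to the left of \<open>[l, r]\<close>, so that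
  \<open>u(l) = 0\<close>.  The Rellich multiplier \<open>v = (x - r) u'\<close> on \<open>[l, r]\<close> is again a polynomial of degree
  at most \<open>p\<close>.  Extended by zero to the right and by a constant to the left it is a finite element
  function, and its left part does not matter because \<open>u\<close> vanishes there.  The real part of
  \<open>a\<^sub>k(u, v) = 0\<close> then reads, after integration by parts,
  \<open>\<integral> (|u'|\<^sup>2 + k\<^sup>2 |u|\<^sup>2) + (r - l) |u'(l)|\<^sup>2 = 0\<close> with the integral over \<open>[l, r]\<close>, whence \<open>u = 0\<close> on \<open>[l, r]\<close> (\<open>rellich_vanishing\<close> and
  \<open>vanishing_propagates_over_element\<close>).  No step restricts the size of \<open>k\<close> or of the elements.

  The translation into matrices uses that \<open>a\<^sub>k\<close> is sesquilinear on the finite element space and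
  that nodal values determine a finite element function (\<open>fe_determined_by_nodal_values\<close>): a
  vector in the kernel of the matrix is a function \<open>u\<close> orthogonal to the Lagrange basis, hence to
  the whole space.
\<close>

section \<open>Meshes of an interval\<close>

lemma mesh_element_bounds:
  assumes "is_mesh a b \<T>" "{l..r} \<in> \<T>"
  shows "l < r" "a \<le> l" "r \<le> b"
proof -
  show "l < r"
    using assms by (auto simp: is_mesh_def)
  moreover have "{l..r} \<subseteq> {a..b}"
    using assms unfolding is_mesh_def by (meson division_ofD(2))
  ultimately show "a \<le> l" "r \<le> b"
    by auto
qed

lemma mesh_element:
  assumes mesh: "is_mesh a b \<T>" and K: "K \<in> \<T>"
  obtains l r where "l < r" "K = {l..r}" "interior K = {l<..<r}" "a \<le> l" "r \<le> b"
proof -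
  obtain l r where "K = {l..r}"
    using mesh K division_ofD(4)[of \<T> "{a..b}" K] by (auto simp: is_mesh_def)
  then show ?thesis
    using mesh_element_bounds[OF mesh, of l r] K that[of l r] by auto
qed

lemma mesh_finite: "is_mesh a b \<T> \<Longrightarrow> finite \<T>"
  by (auto simp: is_mesh_def)

lemma mesh_cover: "is_mesh a b \<T> \<Longrightarrow> \<Union>\<T> = {a..b}"
  by (auto simp: is_mesh_def)

lemma mesh_elements_ordered:
  assumes "is_mesh a b \<T>" "{l..r} \<in> \<T>" "{l'..r'} \<in> \<T>" "{l..r} \<noteq> {l'..r'}"
  shows "r' \<le> l \<or> r \<le> l'"
proof (rule ccontr)
  assume "\<not> ?thesis"
  moreover have "l < r" "l' < r'"
    using mesh_element_bounds(1)[OF assms(1)] assms(2,3) by auto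
  ultimately have "max l l' < min r r'"
    by auto
  moreover have "interior {l..r} \<inter> interior {l'..r'} = {}"
    using assms unfolding is_mesh_def by (meson division_ofD(5))
  ultimately show False
    by (simp del: max_less_iff_conj min_less_iff_conj)
qed

definition mesh_points :: "real set set \<Rightarrow> real set" where
  "mesh_points \<T> = (\<Union>K\<in>\<T>. K - interior K)"

lemma finite_mesh_points: "is_mesh a b \<T> \<Longrightarrow> finite (mesh_points \<T>)"
  unfolding mesh_points_def
proof (intro finite_UN_I mesh_finite)
  fix K assume "is_mesh a b \<T>" "K \<in> \<T>"
  then obtain l r where "K - interior K = {l..r} - {l<..<r}"
    by (metis mesh_element)
  moreover have "{l..r} - {l<..<r} \<subseteq> {l, r}"
    by auto
  ultimately show "finite (K - interior K)"
    by (metis finite.emptyI finite.insertI finite_subset)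
qed

lemma mesh_interior_cover:
  "is_mesh a b \<T> \<Longrightarrow> {a<..<b} \<subseteq> (\<Union>K\<in>\<T>. interior K) \<union> mesh_points \<T>"
  using mesh_cover[of a b \<T>] unfolding mesh_points_def by fastforce

section \<open>Elementwise continuous functions and their integrals\<close>

text \<open>
  Finite element functions and their derivatives are both of this kind.  Continuity of \<open>g\<close> on the
  closed element makes the function bounded and hence integrable.  The values at the mesh points
  are left open because the pointwise derivative of a finite element function need not exist
  there.
\<close>

definition elementwise_continuous :: "real set set \<Rightarrow> (real \<Rightarrow> complex) \<Rightarrow> bool" where
  "elementwise_continuous \<T> f \<longleftrightarrow>
    (\<forall>K\<in>\<T>. \<exists>g. continuous_on K g \<and> (\<forall>x\<in>interior K. f x = g x))"

lemma elementwise_continuous_mult: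
  assumes "elementwise_continuous \<T> f" "elementwise_continuous \<T> g"
  shows "elementwise_continuous \<T> (\<lambda>x. f x * g x)"
  unfolding elementwise_continuous_def
proof
  fix K assume "K \<in> \<T>"
  then obtain f' g' where "continuous_on K f'" "\<forall>x\<in>interior K. f x = f' x"
      "continuous_on K g'" "\<forall>x\<in>interior K. g x = g' x"
    using assms unfolding elementwise_continuous_def by meson
  then show "\<exists>h. continuous_on K h \<and> (\<forall>x\<in>interior K. f x * g x = h x)"
    by (intro exI[of _ "\<lambda>x. f' x * g' x"]) (auto intro!: continuous_intros)
qed

lemma elementwise_continuous_cnj:
  assumes "elementwise_continuous \<T> f"
  shows "elementwise_continuous \<T> (\<lambda>x. cnj (f x))"
  unfolding elementwise_continuous_def
proof
  fix K assume "K \<in> \<T>"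
  then obtain f' where "continuous_on K f'" "\<forall>x\<in>interior K. f x = f' x"
    using assms unfolding elementwise_continuous_def by meson
  then show "\<exists>h. continuous_on K h \<and> (\<forall>x\<in>interior K. cnj (f x) = h x)"
    by (intro exI[of _ "\<lambda>x. cnj (f' x)"]) (auto intro!: continuous_intros)
qed

lemma elementwise_continuous_linear_combination:
  assumes "\<And>i. i \<in> I \<Longrightarrow> elementwise_continuous \<T> (f i)"
  shows "elementwise_continuous \<T> (\<lambda>x. \<Sum>i\<in>I. c i * f i x)"
  unfolding elementwise_continuous_def
proof
  fix K assume "K \<in> \<T>"
  then have "\<forall>i\<in>I. \<exists>g. continuous_on K g \<and> (\<forall>x\<in>interior K. f i x = g x)"
    using assms unfolding elementwise_continuous_def by blast
  then obtain g where "\<forall>i\<in>I. continuous_on K (g i) \<and> (\<forall>x\<in>interior K. f i x = g i x)"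
    by metis
  then show "\<exists>h. continuous_on K h \<and> (\<forall>x\<in>interior K. (\<Sum>i\<in>I. c i * f i x) = h x)"
    by (intro exI[of _ "\<lambda>x. \<Sum>i\<in>I. c i * g i x"]) (auto intro!: continuous_intros)
qed

text \<open>
  Off the finitely many mesh points the function is continuous up to the boundary of each
  element, and on a finite set every function is integrable.
\<close>

lemma elementwise_continuous_integrable:
  assumes mesh: "is_mesh a b \<T>" and f: "elementwise_continuous \<T> f"
  shows "set_integrable lborel {a<..<b} f"
proof -
  have "set_integrable lborel (interior K) f" if "K \<in> \<T>" for K
  proof -
    obtain g where g: "continuous_on K g" "\<forall>x\<in>interior K. f x = g x"
      using f \<open>K \<in> \<T>\<close> unfolding elementwise_continuous_def by meson
    obtain l r where "K = {l..r}"
      using mesh_element[OF mesh \<open>K \<in> \<T>\<close>] by metis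
    then have "set_integrable lborel K g"
      using g(1) by (simp add: borel_integrable_atLeastAtMost')
    then have "set_integrable lborel (interior K) g"
      by (rule set_integrable_subset) (auto simp: interior_subset)
    then show ?thesis
      using g(2) by (subst set_integrable_cong[of lborel lborel _ "interior K" f g]) auto
  qed
  then have elements: "set_integrable lborel (\<Union>K\<in>\<T>. interior K) f"
    by (intro set_integrable_UN mesh_finite[OF mesh]) auto
  have "set_integrable lborel {x} f" for x
  proof -
    have "set_integrable lborel {x} (\<lambda>_. f x)"
      by (simp add: set_integrable_def)
    then show ?thesis
      by (subst set_integrable_cong[of lborel lborel _ "{x}" f "\<lambda>_. f x"]) auto
  qed
  then have "set_integrable lborel (\<Union>x\<in>mesh_points \<T>. {x}) f"
    by (intro set_integrable_UN finite_mesh_points[OF mesh]) auto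
  moreover have "(\<Union>x\<in>mesh_points \<T>. {x}) \<in> sets lborel"
    using finite_mesh_points[OF mesh] by (simp add: finite_imp_closed)
  ultimately have "set_integrable lborel ((\<Union>K\<in>\<T>. interior K) \<union> (\<Union>x\<in>mesh_points \<T>. {x})) f"
    using elements by (intro set_integrable_Un) (auto intro!: borel_open)
  then show ?thesis
    by (rule set_integrable_subset) (use mesh_interior_cover[OF mesh] in auto)
qed

lemma set_integral_cong_elementwise:
  assumes mesh: "is_mesh a b \<T>"
    and "elementwise_continuous \<T> f" "elementwise_continuous \<T> g"
    and eq: "\<And>K x. K \<in> \<T> \<Longrightarrow> x \<in> interior K \<Longrightarrow> f x = g x"
  shows "(LINT x:{a<..<b}|lborel. f x) = (LINT x:{a<..<b}|lborel. g x)"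
  unfolding set_lebesgue_integral_def
proof (rule integral_cong_AE)
  have "AE x in lborel. x \<notin> mesh_points \<T>"
    using finite_mesh_points[OF mesh]
    by (intro AE_not_in finite_imp_null_set_lborel)
  then show "AE x in lborel. indicator {a<..<b} x *\<^sub>R f x = indicator {a<..<b} x *\<^sub>R g x"
  proof eventually_elim
    case (elim x)
    then show ?case
      using mesh_interior_cover[OF mesh] eq by (auto simp: indicator_def)
  qed
qed (use elementwise_continuous_integrable[OF mesh assms(2)]
    elementwise_continuous_integrable[OF mesh assms(3)] in
    \<open>auto simp: set_integrable_def\<close>)

lemma l2_prod_commute: "l2_prod a b v u = cnj (l2_prod a b u v)"
proof -
  have "(\<lambda>x. indicator {a<..<b} x *\<^sub>R (v x * cnj (u x))) =
      (\<lambda>x. cnj (indicator {a<..<b} x *\<^sub>R (u x * cnj (v x))))"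
    by (auto simp: mult.commute)
  then show ?thesis
    unfolding l2_prod_def set_lebesgue_integral_def by (simp only: Bochner_Integration.integral_cnj)
qed

lemma l2_prod_cong:
  assumes "is_mesh a b \<T>" "elementwise_continuous \<T> f" "elementwise_continuous \<T> f'"
    and "elementwise_continuous \<T> g"
    and "\<And>K x. K \<in> \<T> \<Longrightarrow> x \<in> interior K \<Longrightarrow> f x = f' x"
  shows "l2_prod a b f g = l2_prod a b f' g"
  unfolding l2_prod_def
  by (rule set_integral_cong_elementwise[OF assms(1)])
    (use assms in \<open>auto intro!: elementwise_continuous_mult elementwise_continuous_cnj\<close>)

lemma l2_prod_linear_combination:
  assumes mesh: "is_mesh a b \<T>" and fin: "finite I"
    and "\<And>i. i \<in> I \<Longrightarrow> elementwise_continuous \<T> (f i)" "elementwise_continuous \<T> g"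
  shows "l2_prod a b (\<lambda>x. \<Sum>i\<in>I. c i * f i x) g = (\<Sum>i\<in>I. c i * l2_prod a b (f i) g)"
proof -
  have int: "set_integrable lborel {a<..<b} (\<lambda>x. f i x * cnj (g x))" if "i \<in> I" for i
    using assms that
    by (intro elementwise_continuous_integrable[OF mesh] elementwise_continuous_mult
        elementwise_continuous_cnj)
  have "l2_prod a b (\<lambda>x. \<Sum>i\<in>I. c i * f i x) g =
      (LINT x|lborel. (\<Sum>i\<in>I. c i * (indicator {a<..<b} x *\<^sub>R (f i x * cnj (g x)))))"
    unfolding l2_prod_def set_lebesgue_integral_def
    by (intro Bochner_Integration.integral_cong)
      (auto simp: sum_distrib_right scaleR_sum_right mult.assoc)
  also have "\<dots> = (\<Sum>i\<in>I. c i * l2_prod a b (f i) g)"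
    unfolding l2_prod_def set_lebesgue_integral_def
    using int by (subst Bochner_Integration.integral_sum) (auto simp: set_integrable_def simp del: mult_scaleR_right)
  finally show ?thesis .
qed

section \<open>Finite element functions\<close>

lemma has_vector_derivative_poly_of_real:
  "((\<lambda>x. poly q (complex_of_real x)) has_vector_derivative poly (pderiv q) (of_real x))
    (at x within A)"
  by (rule has_vector_derivative_real_field) (rule poly_DERIV)

lemma continuous_on_poly_of_real: "continuous_on A (\<lambda>x. poly q (complex_of_real x))"
  by (intro continuous_intros)

lemma deriv_fun_eqI:
  assumes "(g has_vector_derivative d) (at x)" "open U" "x \<in> U" "\<And>y. y \<in> U \<Longrightarrow> u y = g y"
  shows "deriv_fun u x = d"
  unfolding deriv_fun_def
  using has_vector_derivative_transform_within_open[OF assms(1-3)] assms(4)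
  by (metis vector_derivative_at)

lemma deriv_fun_poly_on:
  assumes "x \<in> interior K" "\<And>y. y \<in> K \<Longrightarrow> u y = poly q (of_real y)"
  shows "deriv_fun u x = poly (pderiv q) (of_real x)"
  using assms interior_subset[of K]
  by (intro deriv_fun_eqI[OF has_vector_derivative_poly_of_real, of "interior K"]) auto

lemma fe_space_polyE:
  assumes "u \<in> fe_space a b \<T> p" "K \<in> \<T>"
  obtains q where "degree q \<le> p" "\<And>x. x \<in> K \<Longrightarrow> u x = poly q (of_real x)"
  using assms unfolding fe_space_def by blast

lemma elementwise_continuous_fe:
  assumes "u \<in> fe_space a b \<T> p"
  shows "elementwise_continuous \<T> u"
  unfolding elementwise_continuous_def
proof
  fix K assume "K \<in> \<T>"
  then obtain q where "\<And>x. x \<in> K \<Longrightarrow> u x = poly q (of_real x)"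
    using fe_space_polyE[OF assms] by metis
  then show "\<exists>g. continuous_on K g \<and> (\<forall>x\<in>interior K. u x = g x)"
    using interior_subset[of K]
    by (intro exI[of _ "\<lambda>x. poly q (of_real x)"]) (auto intro!: continuous_on_poly_of_real)
qed

lemma elementwise_continuous_deriv_fe:
  assumes "u \<in> fe_space a b \<T> p"
  shows "elementwise_continuous \<T> (deriv_fun u)"
  unfolding elementwise_continuous_def
proof
  fix K assume "K \<in> \<T>"
  then obtain q where "\<And>x. x \<in> K \<Longrightarrow> u x = poly q (of_real x)"
    using fe_space_polyE[OF assms] by metis
  then show "\<exists>g. continuous_on K g \<and> (\<forall>x\<in>interior K. deriv_fun u x = g x)"
    by (intro exI[of _ "\<lambda>x. poly (pderiv q) (of_real x)"])
      (auto intro!: continuous_on_poly_of_real deriv_fun_poly_on)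
qed

lemma fe_space_linear_combination:
  assumes "finite I" "\<And>i. i \<in> I \<Longrightarrow> f i \<in> fe_space a b \<T> p"
  shows "(\<lambda>x. \<Sum>i\<in>I. c i * f i x) \<in> fe_space a b \<T> p"
proof -
  have "\<exists>q. degree q \<le> p \<and> (\<forall>x\<in>K. (\<Sum>i\<in>I. c i * f i x) = poly q (of_real x))"
    if "K \<in> \<T>" for K
  proof -
    have "\<forall>i\<in>I. \<exists>q. degree q \<le> p \<and> (\<forall>x\<in>K. f i x = poly q (of_real x))"
      using assms(2) that unfolding fe_space_def by blast
    then obtain q where
      q: "\<And>i. i \<in> I \<Longrightarrow> degree (q i) \<le> p \<and> (\<forall>x\<in>K. f i x = poly (q i) (of_real x))"
      by metis
    have "degree (\<Sum>i\<in>I. Polynomial.smult (c i) (q i)) \<le> p"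
      using q by (intro degree_sum_le assms(1)) (meson degree_smult_le le_trans)
    moreover have "\<forall>x\<in>K. (\<Sum>i\<in>I. c i * f i x) = poly (\<Sum>i\<in>I. Polynomial.smult (c i) (q i)) (of_real x)"
      using q by (auto simp: poly_sum)
    ultimately show ?thesis
      by blast
  qed
  then show ?thesis
    using assms(2) by (auto simp: fe_space_def intro!: continuous_intros)
qed

lemma deriv_fun_linear_combination:
  assumes "\<And>i. i \<in> I \<Longrightarrow> f i \<in> fe_space a b \<T> p" "K \<in> \<T>" "x \<in> interior K"
  shows "deriv_fun (\<lambda>x. \<Sum>i\<in>I. c i * f i x) x = (\<Sum>i\<in>I. c i * deriv_fun (f i) x)"
proof -
  have "(f i has_vector_derivative deriv_fun (f i) x) (at x)" if i: "i \<in> I" for i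
  proof -
    obtain q where q: "\<And>x. x \<in> K \<Longrightarrow> f i x = poly q (of_real x)"
      using fe_space_polyE[OF assms(1)[OF i] assms(2)] by metis
    have "(f i has_vector_derivative poly (pderiv q) (of_real x)) (at x)"
      using q assms(3) interior_subset[of K]
      by (intro has_vector_derivative_transform_within_open[OF has_vector_derivative_poly_of_real,
            of "interior K"]) auto
    then show ?thesis
      by (simp add: deriv_fun_def vector_derivative_at)
  qed
  then have "((\<lambda>x. \<Sum>i\<in>I. c i * f i x) has_vector_derivative (\<Sum>i\<in>I. c i * deriv_fun (f i) x)) (at x)"
    by (intro has_vector_derivative_sum has_vector_derivative_mult_right)
  then show ?thesis
    by (simp add: deriv_fun_def vector_derivative_at)
qed

section \<open>The sesquilinear form on the finite element space\<close>

lemma helmholtz_form_linear_combination_left: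
  assumes mesh: "is_mesh a b \<T>" and fin: "finite I"
    and f: "\<And>i. i \<in> I \<Longrightarrow> f i \<in> fe_space a b \<T> p" and v: "v \<in> fe_space a b \<T> p"
  shows "helmholtz_form a b k (\<lambda>x. \<Sum>i\<in>I. c i * f i x) v =
    (\<Sum>i\<in>I. c i * helmholtz_form a b k (f i) v)"
proof -
  have "l2_prod a b (deriv_fun (\<lambda>x. \<Sum>i\<in>I. c i * f i x)) (deriv_fun v) =
      l2_prod a b (\<lambda>x. \<Sum>i\<in>I. c i * deriv_fun (f i) x) (deriv_fun v)"
    using f v fin
    by (intro l2_prod_cong[OF mesh] elementwise_continuous_linear_combination
        elementwise_continuous_deriv_fe[of _ a b \<T> p] fe_space_linear_combination
        deriv_fun_linear_combination[of I f a b \<T> p])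
  also have "\<dots> = (\<Sum>i\<in>I. c i * l2_prod a b (deriv_fun (f i)) (deriv_fun v))"
    using f v by (intro l2_prod_linear_combination[OF mesh fin] elementwise_continuous_deriv_fe)
  finally have stiffness: "l2_prod a b (deriv_fun (\<lambda>x. \<Sum>i\<in>I. c i * f i x)) (deriv_fun v) =
      (\<Sum>i\<in>I. c i * l2_prod a b (deriv_fun (f i)) (deriv_fun v))" .
  have mass: "l2_prod a b (\<lambda>x. \<Sum>i\<in>I. c i * f i x) v = (\<Sum>i\<in>I. c i * l2_prod a b (f i) v)"
    using f v by (intro l2_prod_linear_combination[OF mesh fin] elementwise_continuous_fe)
  have bdry: "bdry_prod a b (\<lambda>x. \<Sum>i\<in>I. c i * f i x) v = (\<Sum>i\<in>I. c i * bdry_prod a b (f i) v)"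
    by (simp add: bdry_prod_def sum_distrib_right distrib_left sum.distrib mult.assoc)
  show ?thesis
    unfolding helmholtz_form_def stiffness mass bdry
    by (simp add: sum_distrib_left sum_subtractf sum.distrib algebra_simps)
qed

text \<open>
  Every term of the form except for the factor of the boundary term is Hermitian, and replacing
  \<open>k\<close> by \<open>-k\<close> conjugates that factor.
\<close>

lemma helmholtz_form_adjoint:
  "helmholtz_form a b k u v = cnj (helmholtz_form a b (-k) v u)"
  unfolding helmholtz_form_def
  by (subst (1 2) l2_prod_commute) (simp add: bdry_prod_def mult.commute)

lemma helmholtz_form_linear_combination_right:
  assumes "is_mesh a b \<T>" "finite I"
    and "\<And>i. i \<in> I \<Longrightarrow> f i \<in> fe_space a b \<T> p" "u \<in> fe_space a b \<T> p"
  shows "helmholtz_form a b k u (\<lambda>x. \<Sum>i\<in>I. c i * f i x) =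
    (\<Sum>i\<in>I. cnj (c i) * helmholtz_form a b k u (f i))"
  by (subst (1 2) helmholtz_form_adjoint)
    (simp add: helmholtz_form_linear_combination_left[OF assms])

lemma helmholtz_form_cong_right:
  assumes "a \<le> b" "\<And>x. x \<in> {a..b} \<Longrightarrow> v x = w x"
  shows "helmholtz_form a b k u v = helmholtz_form a b k u w"
proof -
  have deriv: "deriv_fun v x = deriv_fun w x" if "x \<in> {a<..<b}" for x
  proof -
    have "\<forall>\<^sub>F y in nhds x. y \<in> UNIV \<longrightarrow> v y = w y"
      using that assms(2) by (intro eventually_nhds_in_open[THEN eventually_mono, of "{a<..<b}"]) auto
    then show ?thesis
      unfolding deriv_fun_def by (rule vector_derivative_cong_eq) (auto)
  qed
  have "l2_prod a b (deriv_fun u) (deriv_fun v) = l2_prod a b (deriv_fun u) (deriv_fun w)"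
    unfolding l2_prod_def by (rule set_lebesgue_integral_cong) (use deriv in auto)
  moreover have "l2_prod a b u v = l2_prod a b u w"
    unfolding l2_prod_def by (rule set_lebesgue_integral_cong) (use assms in auto)
  moreover have "bdry_prod a b u v = bdry_prod a b u w"
    using assms by (simp add: bdry_prod_def)
  ultimately show ?thesis
    by (simp add: helmholtz_form_def)
qed

text \<open>
  The two volume terms of \<open>a\<^sub>k(u, u)\<close> are real, so its imaginary part is the boundary term alone.
\<close>

lemma helmholtz_form_kernel_boundary:
  assumes "helmholtz_form a b k u u = 0" "k \<noteq> 0"
  shows "u a = 0" "u b = 0"
proof -
  have real: "Im (l2_prod a b f f) = 0" for f
    using l2_prod_commute[of a b f f] by (metis Im_complex_of_real Reals_cnj_iff of_real_Re)
  have "Im (helmholtz_form a b k u u) = - k * ((cmod (u a))\<^sup>2 + (cmod (u b))\<^sup>2)"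
    unfolding cmod_power2
    by (simp add: helmholtz_form_def bdry_prod_def real power2_eq_square algebra_simps)
  then have "(cmod (u a))\<^sup>2 + (cmod (u b))\<^sup>2 = 0"
    using assms by simp
  then show "u a = 0" "u b = 0"
    by (auto simp: add_nonneg_eq_0_iff)
qed

section \<open>Unique continuation over one element\<close>

lemma has_real_derivative_cmod_square:
  assumes "(f has_vector_derivative f') (at x within A)"
  shows "((\<lambda>x. (cmod (f x))\<^sup>2) has_real_derivative 2 * Re (f x * cnj f')) (at x within A)"
proof -
  have re: "((\<lambda>x. Re (f x)) has_real_derivative Re f') (at x within A)"
    and im: "((\<lambda>x. Im (f x)) has_real_derivative Im f') (at x within A)"
    using bounded_linear.has_vector_derivative[OF bounded_linear_Re assms]
      bounded_linear.has_vector_derivative[OF bounded_linear_Im assms]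
    by (simp_all add: has_real_derivative_iff_has_vector_derivative)
  show ?thesis
    unfolding cmod_power2
    using DERIV_add[OF DERIV_power[OF re, of 2] DERIV_power[OF im, of 2]]
    by (simp add: algebra_simps)
qed

text \<open>
  A one-dimensional Rellich identity.  The difference of the two integrands is the derivative of
  \<open>(x - r) (|q'|\<^sup>2 - k\<^sup>2 |q|\<^sup>2) / 2\<close>, because \<open>2 Re (f \<cdot> cnj f')\<close> is the derivative of \<open>|f|\<^sup>2\<close>.
  The factor \<open>x - r\<close> removes the boundary term at \<open>r\<close>, and the remaining boundary term at \<open>l\<close> has
  a favourable sign as soon as \<open>q\<close> vanishes at \<open>l\<close>.
\<close>

lemma rellich_identity:
  fixes q :: "complex poly" and l r k :: real
  defines "w \<equiv> [:- of_real r, 1:] * pderiv q"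
  assumes "l \<le> r"
  shows "((\<lambda>x. Re (poly (pderiv q) (of_real x) * cnj (poly (pderiv w) (of_real x))
            - (of_real k)\<^sup>2 * (poly q (of_real x) * cnj (poly w (of_real x))))
          - ((cmod (poly (pderiv q) (of_real x)))\<^sup>2 + k\<^sup>2 * (cmod (poly q (of_real x)))\<^sup>2) / 2)
      has_integral (r - l) / 2 * ((cmod (poly (pderiv q) (of_real l)))\<^sup>2
          - k\<^sup>2 * (cmod (poly q (of_real l)))\<^sup>2)) {l..r}"
proof -
  let ?q = "\<lambda>x::real. poly q (of_real x)"
  let ?q' = "\<lambda>x::real. poly (pderiv q) (of_real x)"
  let ?q'' = "\<lambda>x::real. poly (pderiv (pderiv q)) (of_real x)"
  let ?G = "\<lambda>x. (x - r) / 2 * ((cmod (?q' x))\<^sup>2 - k\<^sup>2 * (cmod (?q x))\<^sup>2)"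
  let ?h = "\<lambda>x. Re (?q' x * cnj (poly (pderiv w) (of_real x))
            - (of_real k)\<^sup>2 * (?q x * cnj (poly w (of_real x))))
          - ((cmod (?q' x))\<^sup>2 + k\<^sup>2 * (cmod (?q x))\<^sup>2) / 2"
  have "(?G has_real_derivative ?h x) (at x within {l..r})" for x
  proof -
    have "(?G has_real_derivative
        (1 / 2) * ((cmod (?q' x))\<^sup>2 - k\<^sup>2 * (cmod (?q x))\<^sup>2)
        + (x - r) / 2 * (2 * Re (?q' x * cnj (?q'' x)) - k\<^sup>2 * (2 * Re (?q x * cnj (?q' x)))))
        (at x within {l..r})"
    proof (rule DERIV_cong[OF DERIV_mult])
      show "((\<lambda>x. (x - r) / 2) has_real_derivative 1 / 2) (at x within {l..r})"
        by (rule DERIV_cong[OF DERIV_cdivide[OF DERIV_diff[OF DERIV_ident DERIV_const]]]) simp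
      show "((\<lambda>x. (cmod (?q' x))\<^sup>2 - k\<^sup>2 * (cmod (?q x))\<^sup>2) has_real_derivative
          2 * Re (?q' x * cnj (?q'' x)) - k\<^sup>2 * (2 * Re (?q x * cnj (?q' x)))) (at x within {l..r})"
        by (intro DERIV_diff DERIV_cmult has_real_derivative_cmod_square
            has_vector_derivative_poly_of_real)
    qed (rule arg_cong2[of _ _ _ _ "(+)", OF refl mult.commute])
    moreover have w: "poly w (of_real x) = of_real (x - r) * ?q' x"
        "poly (pderiv w) (of_real x) = ?q' x + of_real (x - r) * ?q'' x"
      unfolding w_def pderiv_mult by (simp_all add: pderiv_pCons algebra_simps)
    have "?h x = (1 / 2) * ((cmod (?q' x))\<^sup>2 - k\<^sup>2 * (cmod (?q x))\<^sup>2)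
        + (x - r) / 2 * (2 * Re (?q' x * cnj (?q'' x)) - k\<^sup>2 * (2 * Re (?q x * cnj (?q' x))))"
      unfolding w cmod_power2 by (simp add: power2_eq_square field_simps)
    ultimately show ?thesis
      by simp
  qed
  then have "(?h has_integral ?G r - ?G l) {l..r}"
    using assms(2)
    by (intro fundamental_theorem_of_calculus)
      (auto simp: has_real_derivative_iff_has_vector_derivative)
  moreover have "?G r - ?G l = (r - l) / 2 * ((cmod (?q' l))\<^sup>2 - k\<^sup>2 * (cmod (?q l))\<^sup>2)"
    by (simp add: field_simps)
  ultimately show ?thesis
    by (simp only:)
qed

text \<open>
  With \<open>q(l) = 0\<close>, the integral of the nonnegative function \<open>(|q'|\<^sup>2 + k\<^sup>2 |q|\<^sup>2) / 2\<close> equals the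
  nonpositive number \<open>- (r - l) / 2 |q'(l)|\<^sup>2\<close>, so both are zero.
\<close>

lemma rellich_vanishing:
  fixes q :: "complex poly" and l r k :: real
  defines "w \<equiv> [:- of_real r, 1:] * pderiv q"
  assumes lr: "l < r" and k: "k \<noteq> 0" and ql: "poly q (of_real l) = 0"
    and zero: "Re (integral {l..r} (\<lambda>x. poly (pderiv q) (of_real x) * cnj (poly (pderiv w) (of_real x))
            - (of_real k)\<^sup>2 * (poly q (of_real x) * cnj (poly w (of_real x))))) = 0"
    and x: "x \<in> {l..r}"
  shows "poly q (of_real x) = 0"
proof -
  let ?e = "\<lambda>x::real. poly (pderiv q) (of_real x) * cnj (poly (pderiv w) (of_real x))
            - (of_real k)\<^sup>2 * (poly q (of_real x) * cnj (poly w (of_real x)))"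
  let ?s = "\<lambda>x::real. ((cmod (poly (pderiv q) (of_real x)))\<^sup>2
      + k\<^sup>2 * (cmod (poly q (of_real x)))\<^sup>2) / 2"
  let ?B = "(r - l) / 2 * (cmod (poly (pderiv q) (of_real l)))\<^sup>2"
  have "?e integrable_on {l..r}"
    by (intro integrable_continuous_interval continuous_intros)
  then have "((Re \<circ> ?e) has_integral Re (integral {l..r} ?e)) {l..r}"
    by (intro has_integral_linear integrable_integral bounded_linear_Re)
  then have "((Re \<circ> ?e) has_integral 0) {l..r}"
    unfolding zero .
  moreover have "((\<lambda>x. Re (?e x) - ?s x) has_integral ?B) {l..r}"
    using rellich_identity[of l r q k] lr ql unfolding w_def by simp
  ultimately have "((\<lambda>x. (Re \<circ> ?e) x - (Re (?e x) - ?s x)) has_integral 0 - ?B) {l..r}"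
    by (rule has_integral_diff)
  then have s: "(?s has_integral - ?B) {l..r}"
    by simp
  have "0 \<le> - ?B"
    by (rule has_integral_nonneg[OF s]) auto
  moreover have "0 \<le> ?B"
    using lr by simp
  ultimately have "- ?B = 0"
    by linarith
  with s have "(?s has_integral 0) {l..r}"
    by (simp only:)
  then have "?s x = 0"
    using lr x
    by (intro has_integral_0_cbox_imp_0[where f = ?s and a = l and b = r])
      (auto intro!: continuous_intros)
  then show ?thesis
    using k by (auto simp: add_nonneg_eq_0_iff)
qed

text \<open>
  Clamping the argument to \<open>{l..r}\<close> extends the polynomial by its end point values, so continuity
  and the degree bound on the other elements are automatic.
\<close>

lemma clamped_poly_in_fe_space:
  assumes mesh: "is_mesh a b \<T>" and K: "{l..r} \<in> \<T>" and w: "degree w \<le> p"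
  shows "(\<lambda>x. poly w (of_real (max l (min x r)))) \<in> fe_space a b \<T> p"
proof -
  have lr: "l < r"
    by (rule mesh_element_bounds(1)[OF mesh K])
  have "\<exists>q. degree q \<le> p \<and> (\<forall>x\<in>K'. poly w (of_real (max l (min x r))) = poly q (of_real x))"
    if K'_elem: "K' \<in> \<T>" for K'
  proof (cases "K' = {l..r}")
    case True
    then show ?thesis
      using w by (intro exI[of _ w]) auto
  next
    case False
    obtain l' r' where K': "K' = {l'..r'}"
      using mesh_element[OF mesh K'_elem] by metis
    then consider "r' \<le> l" | "r \<le> l'"
      using mesh_elements_ordered[OF mesh K] K'_elem False by blast
    then show ?thesis
    proof cases
      case 1
      then have "max l (min x r) = l" if "x \<in> K'" for x
        using that K' lr by auto
      then show ?thesis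
        by (intro exI[of _ "[:poly w (of_real l):]"]) simp
    next
      case 2
      then have "max l (min x r) = r" if "x \<in> K'" for x
        using that K' lr by auto
      then show ?thesis
        by (intro exI[of _ "[:poly w (of_real r):]"]) simp
    qed
  qed
  then show ?thesis
    by (auto simp: fe_space_def intro!: continuous_intros)
qed

text \<open>
  The test function is \<open>(x - r) u'\<close> on the element, extended by constants: it has the right degree,
  it is zero to the right of the element, and to the left of the element, where it is nonzero
  in general, \<open>u\<close> vanishes.  The boundary term vanishes with \<open>u(a)\<close> and \<open>u(b)\<close>.  Hence only the
  element contributes to the form.
\<close>

lemma vanishing_propagates_over_element:
  assumes mesh: "is_mesh a b \<T>" and u: "u \<in> fe_space a b \<T> p" and k: "k \<noteq> 0"
    and orth: "\<And>v. v \<in> fe_space a b \<T> p \<Longrightarrow> helmholtz_form a b k u v = 0"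
    and bdry: "u a = 0" "u b = 0"
    and K: "{l..r} \<in> \<T>" and left: "\<And>x. a \<le> x \<Longrightarrow> x \<le> l \<Longrightarrow> u x = 0"
    and x: "x \<in> {l..r}"
  shows "u x = 0"
proof -
  have lr: "l < r" "a \<le> l" "r \<le> b"
    using mesh_element_bounds[OF mesh K] by auto
  obtain q where q: "degree q \<le> p" "\<And>x. x \<in> {l..r} \<Longrightarrow> u x = poly q (of_real x)"
    using fe_space_polyE[OF u K] by metis
  define w where "w = [:- of_real r, 1:] * pderiv q"
  have "degree w \<le> p"
  proof (cases "pderiv q = 0")
    case False
    then have "degree q \<noteq> 0"
      by (auto simp: pderiv_eq_0_iff)
    moreover have "degree w \<le> 1 + degree (pderiv q)"
      unfolding w_def by (rule order_trans[OF degree_mult_le]) simp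
    ultimately show ?thesis
      using q(1) by (simp add: degree_pderiv)
  qed (simp add: w_def)
  define v where "v = (\<lambda>x. poly w (complex_of_real (max l (min x r))))"
  have v: "v \<in> fe_space a b \<T> p"
    unfolding v_def by (rule clamped_poly_in_fe_space[OF mesh K \<open>degree w \<le> p\<close>])
  let ?e = "\<lambda>x. deriv_fun u x * cnj (deriv_fun v x) - (of_real k)\<^sup>2 * (u x * cnj (v x))"
  let ?P = "\<lambda>x::real. poly (pderiv q) (of_real x) * cnj (poly (pderiv w) (of_real x))
            - (of_real k)\<^sup>2 * (poly q (of_real x) * cnj (poly w (of_real x)))"
  have int1: "set_integrable lborel {a<..<b} (\<lambda>x. deriv_fun u x * cnj (deriv_fun v x))"
    by (intro elementwise_continuous_integrable[OF mesh] elementwise_continuous_mult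
        elementwise_continuous_cnj elementwise_continuous_deriv_fe[OF u]
        elementwise_continuous_deriv_fe[OF v])
  have int2: "set_integrable lborel {a<..<b} (\<lambda>x. (of_real k)\<^sup>2 * (u x * cnj (v x)))"
    by (intro set_integrable_mult_right elementwise_continuous_integrable[OF mesh]
        elementwise_continuous_mult elementwise_continuous_cnj elementwise_continuous_fe[OF u]
        elementwise_continuous_fe[OF v])
  have intP: "set_integrable lborel {l..r} ?P"
    by (intro borel_integrable_atLeastAtMost' continuous_intros)
  have "(LINT x:{a<..<b}|lborel. ?e x) = helmholtz_form a b k u v"
    using int1 int2 bdry
    by (simp add: helmholtz_form_def l2_prod_def set_integral_diff bdry_prod_def)
  then have "(LINT x:{a<..<b}|lborel. ?e x) = 0"
    using orth[OF v] by simp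
  also have "(LINT x:{a<..<b}|lborel. ?e x) = (LINT x:{l..r}|lborel. ?P x)"
    unfolding set_lebesgue_integral_def
  proof (rule integral_cong_AE)
    have "AE x in lborel. x \<notin> {l, r}"
      by (intro AE_not_in finite_imp_null_set_lborel) auto
    then show "AE x in lborel. indicator {a<..<b} x *\<^sub>R ?e x = indicator {l..r} x *\<^sub>R ?P x"
    proof eventually_elim
      case (elim x)
      \<comment> \<open>Outside the element one factor of each product is zero: \<open>u\<close> and its derivative on the
        left, \<open>v\<close> and its derivative on the right.\<close>
      consider "x \<notin> {a<..<b}" "x \<notin> {l..r}" | "a < x" "x < l" | "l < x" "x < r" | "r < x" "x < b"
        using elim lr by force
      then show ?case
      proof cases
        case 2
        then have "deriv_fun u x = 0"
          using left by (intro deriv_fun_eqI[of "\<lambda>_. 0" _ _ "{a<..<l}"]) auto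
        then show ?thesis
          using 2 left by (simp add: indicator_def)
      next
        case 3
        then have "deriv_fun u x = poly (pderiv q) (of_real x)"
          using q(2) by (intro deriv_fun_poly_on[of _ "{l..r}"]) auto
        moreover have "deriv_fun v x = poly (pderiv w) (of_real x)"
          using 3 by (intro deriv_fun_poly_on[of _ "{l..r}"]) (auto simp: v_def)
        ultimately show ?thesis
          using 3 lr q(2) by (simp add: indicator_def v_def)
      next
        case 4
        have right: "v y = 0" if "y > r" for y
          using that lr by (simp add: v_def w_def)
        then have "deriv_fun v x = 0"
          using 4 by (intro deriv_fun_eqI[of "\<lambda>_. 0" _ _ "{r<..}"]) auto
        then show ?thesis
          using 4 right by (simp add: indicator_def)
      qed (auto simp: indicator_def)
    qed
  qed (use set_integral_diff(1)[OF int1 int2] intP in \<open>auto simp: set_integrable_def\<close>)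
  also have "\<dots> = integral {l..r} ?P"
    using intP by (rule set_borel_integral_eq_integral)
  finally have "Re (integral {l..r} ?P) = 0"
    by simp
  moreover have "poly q (of_real l) = 0"
    using q(2)[of l] left[of l] lr by simp
  ultimately have "poly q (of_real x) = 0"
    using rellich_vanishing[OF lr(1) k _ _ x, of q] unfolding w_def by blast
  then show ?thesis
    using q(2) x by simp
qed

section \<open>Uniqueness of the discrete solution\<close>

lemma fe_vanishes_left_of_element:
  assumes mesh: "is_mesh a b \<T>" and u: "u \<in> fe_space a b \<T> p"
    and l: "a \<le> l" "l \<le> b" and ua: "u a = 0"
    and prev: "\<And>l' r' y. {l'..r'} \<in> \<T> \<Longrightarrow> l' < l \<Longrightarrow> y \<in> {l'..r'} \<Longrightarrow> u y = 0"
    and x: "a \<le> x" "x \<le> l"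
  shows "u x = 0"
proof -
  have less: "u y = 0" if y: "a \<le> y" "y < l" for y
  proof -
    obtain K where "K \<in> \<T>" "y \<in> K"
      using mesh_cover[OF mesh] y l by (metis UnionE atLeastAtMost_iff less_imp_le order_trans)
    moreover obtain l' r' where "K = {l'..r'}"
      using mesh_element[OF mesh \<open>K \<in> \<T>\<close>] by metis
    ultimately show ?thesis
      using prev[of l' r' y] y by auto
  qed
  \<comment> \<open>At \<open>l\<close> itself, the boundary condition or continuity from the left applies.\<close>
  show ?thesis
  proof (cases "x < l")
    case False
    show ?thesis
    proof (cases "a = l")
      case False
      then have "a < l"
        using l by simp
      have "continuous_on {a..l} u"
        using u l by (auto simp: fe_space_def intro: continuous_on_subset)
      moreover have "\<And>y. y \<in> {a<..<l} \<Longrightarrow> u y = 0"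
        using less by simp
      ultimately have "u l = 0"
        using continuous_constant_on_closure[of "{a<..<l}" u 0 l] \<open>a < l\<close> by simp
      then show ?thesis
        using \<open>\<not> x < l\<close> x by simp
    qed (use x ua in simp)
  qed (use less x in simp)
qed

lemma helmholtz_form_kernel_trivial:
  assumes ab: "a < b" and mesh: "is_mesh a b \<T>" and k: "k \<noteq> 0"
    and u: "u \<in> fe_space a b \<T> p"
    and orth: "\<And>v. v \<in> fe_space a b \<T> p \<Longrightarrow> helmholtz_form a b k u v = 0"
    and x: "x \<in> {a..b}"
  shows "u x = 0"
proof -
  have bdry: "u a = 0" "u b = 0"
    using helmholtz_form_kernel_boundary[OF orth[OF u] k] by auto
  have elements: "\<forall>y\<in>K. u y = 0" if "K \<in> \<T>" for K
    using mesh_finite[OF mesh] that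
  \<comment> \<open>Left-to-right traversal: induction on the number of elements that start further left.\<close>
  proof (induction K rule: measure_induct_rule[of "\<lambda>K. card {K'\<in>\<T>. Inf K' < Inf K}"])
    case (less K)
    obtain l r where K: "l < r" "K = {l..r}" "a \<le> l" "r \<le> b"
      using mesh_element[OF mesh \<open>K \<in> \<T>\<close>] by metis
    have prev: "u y = 0" if K': "{l'..r'} \<in> \<T>" "l' < l" "y \<in> {l'..r'}" for l' r' y
    proof -
      have Inf: "Inf {l'..r'} < Inf K"
        using K K' by simp
      have "{K''\<in>\<T>. Inf K'' < Inf {l'..r'}} \<subseteq> {K''\<in>\<T>. Inf K'' < Inf K}"
        using less_trans[OF _ Inf] by blast
      moreover have "{l'..r'} \<in> {K''\<in>\<T>. Inf K'' < Inf K}"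
        using K'(1) Inf by (intro CollectI conjI)
      ultimately have "{K''\<in>\<T>. Inf K'' < Inf {l'..r'}} \<subset> {K''\<in>\<T>. Inf K'' < Inf K}"
        by (metis (no_types, lifting) less_irrefl mem_Collect_eq psubsetI)
      then have "card {K''\<in>\<T>. Inf K'' < Inf {l'..r'}} < card {K''\<in>\<T>. Inf K'' < Inf K}"
        using less.prems(1) by (intro psubset_card_mono) auto
      then show ?thesis
        using less.IH less.prems(1) K' by blast
    qed
    have left: "u y = 0" if "a \<le> y" "y \<le> l" for y
      using fe_vanishes_left_of_element[OF mesh u, of l y] K bdry(1) prev that by auto
    show ?case
      using vanishing_propagates_over_element[OF mesh u k orth bdry _ left] less.prems(2)
      unfolding K(2) by blast
  qed
  then show ?thesis
    using mesh_cover[OF mesh] x by blast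
qed

section \<open>The Lagrange basis\<close>

lemma nodal_points_subset:
  assumes "is_mesh a b \<T>" "element_maps \<T> F" "N \<subseteq> {0..1}"
  shows "nodal_points \<T> F N \<subseteq> {a..b}"
  using assms mesh_cover[OF assms(1)] unfolding nodal_points_def element_maps_def by blast

text \<open>
  Composing the polynomials on an element with the affine element map transports the question to
  the reference interval, where unisolvence decides it.
\<close>

lemma fe_determined_by_nodal_values:
  assumes mesh: "is_mesh a b \<T>" and N: "unisolvent p N" "N \<subseteq> {0..1}"
    and F: "element_maps \<T> F"
    and u: "u \<in> fe_space a b \<T> p" and v: "v \<in> fe_space a b \<T> p"
    and eq: "\<And>z. z \<in> nodal_points \<T> F N \<Longrightarrow> u z = v z"
    and x: "x \<in> {a..b}"
  shows "u x = v x"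
proof -
  obtain K where K: "K \<in> \<T>" "x \<in> K"
    using mesh_cover[OF mesh] x by blast
  obtain q where q: "degree q \<le> p" "\<And>x. x \<in> K \<Longrightarrow> u x = poly q (of_real x)"
    using fe_space_polyE[OF u K(1)] by metis
  obtain q' where q': "degree q' \<le> p" "\<And>x. x \<in> K \<Longrightarrow> v x = poly q' (of_real x)"
    using fe_space_polyE[OF v K(1)] by metis
  have affine: "\<exists>m c. \<forall>t. F K t = m * t + c" and FK: "F K ` {0..1} = K"
    using bspec[OF F[unfolded element_maps_def] K(1)] by (rule conjunct1, rule conjunct2)
  from affine obtain m c where mc: "\<forall>t. F K t = m * t + c"
    by (elim exE)
  obtain t where t: "t \<in> {0..1}" "x = F K t"
    using FK K(2) by blast
  let ?L = "[:complex_of_real c, of_real m:]"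
  have comp: "poly (pcompose g ?L) (of_real s) = poly g (of_real (F K s))" for g s
    by (simp add: poly_pcompose mc algebra_simps)
  have deg: "degree (pcompose g ?L) \<le> p" if "degree g \<le> p" for g
  proof -
    have "degree (pcompose g ?L) \<le> degree g * degree ?L"
      by (rule degree_pcompose_le)
    also have "\<dots> \<le> degree g * 1"
      by (intro mult_left_mono) auto
    finally show ?thesis
      using that by simp
  qed
  have nodes: "poly (pcompose q' ?L) (of_real s) = poly (pcompose q ?L) (of_real s)" if "s \<in> N" for s
  proof -
    have "F K s \<in> K"
      using FK N(2) that by blast
    moreover have "F K s \<in> nodal_points \<T> F N"
      using K(1) that by (auto simp: nodal_points_def)
    ultimately show ?thesis
      using eq[of "F K s"] q(2)[of "F K s"] q'(2)[of "F K s"] by (simp add: comp)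
  qed
  have "\<exists>!g. degree g \<le> p \<and>
      (\<forall>s\<in>N. poly g (of_real s) = poly (pcompose q ?L) (of_real s))"
    by (rule N(1)[unfolded unisolvent_def, THEN spec])
  moreover note deg[OF q(1)] deg[OF q'(1)] nodes
  ultimately have "pcompose q' ?L = pcompose q ?L"
    by blast
  then have "poly q (of_real x) = poly q' (of_real x)"
    using comp t(2) by metis
  then show ?thesis
    using q(2) q'(2) K(2) by simp
qed

section \<open>Regularity of the system matrix\<close>

lemma invertible_mat_if_trivial_kernel:
  fixes A :: "'a :: field mat"
  assumes A: "A \<in> carrier_mat n n"
    and kernel: "\<And>c. c \<in> carrier_vec n \<Longrightarrow> A *\<^sub>v c = 0\<^sub>v n \<Longrightarrow> c = 0\<^sub>v n"
  shows "invertible_mat A"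
proof -
  have "Determinant.det A \<noteq> 0"
    using det_0_iff_vec_prod_zero_field[OF A] kernel by blast
  then have "A \<in> Units (ring_mat TYPE('a) n ())"
    by (rule det_non_zero_imp_unit[OF A])
  then obtain B where "B \<in> carrier_mat n n" "B * A = 1\<^sub>m n" "A * B = 1\<^sub>m n"
    by (auto simp: Units_def ring_mat_def)
  then show ?thesis
    using A unfolding invertible_mat_def inverts_mat_def by auto
qed

theorem theorem3p1:
  fixes a b k :: real
    and \<T> :: "real set set"
    and p :: nat
    and N :: "real set"
    and F :: "real set \<Rightarrow> real \<Rightarrow> real"
    and \<phi> :: "real \<Rightarrow> real \<Rightarrow> complex"
    and zs :: "real list"
  assumes "a < b"
    and "is_mesh a b \<T>"
    and "p \<ge> 1"
    and "reference_nodes p N"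
    and "element_maps \<T> F"
    and "lagrange_basis (fe_space a b \<T> p) (nodal_points \<T> F N) \<phi>"
    and "distinct zs" and "set zs = nodal_points \<T> F N"
    and "k \<noteq> 0"
  shows "invertible_mat (system_matrix a b k \<phi> zs)"
proof (rule invertible_mat_if_trivial_kernel)
  let ?n = "length zs"
  let ?A = "system_matrix a b k \<phi> zs"
  show "?A \<in> carrier_mat ?n ?n"
    by (simp add: system_matrix_eq_gram_helmholtz_form gram_matrix_def)
  fix c assume c: "c \<in> carrier_vec ?n" and Ac: "?A *\<^sub>v c = 0\<^sub>v ?n"
  have basis: "\<phi> (zs ! i) \<in> fe_space a b \<T> p" if "i < ?n" for i
    using assms(6,8) that by (metis lagrange_basis_def nth_mem)
  have nodal: "(\<Sum>i<?n. d i * \<phi> (zs ! i) (zs ! j)) = d j" if "j < ?n" for d j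
  proof -
    have "\<phi> (zs ! i) (zs ! j) = (if i = j then 1 else 0)" if "i < ?n" for i
      using assms(6,7,8) that \<open>j < ?n\<close>
      by (metis lagrange_basis_def nth_eq_iff_index_eq nth_mem)
    then have "(\<Sum>i<?n. d i * \<phi> (zs ! i) (zs ! j)) = (\<Sum>i<?n. if i = j then d j else 0)"
      by (intro sum.cong) auto
    then show ?thesis
      using that by simp
  qed
  define u where "u = (\<lambda>x. \<Sum>j<?n. (vec_index c j) * \<phi> (zs ! j) x)"
  have u: "u \<in> fe_space a b \<T> p"
    unfolding u_def using basis by (intro fe_space_linear_combination) auto
  have row: "helmholtz_form a b k u (\<phi> (zs ! i)) = 0" if "i < ?n" for i
  proof -
    have "helmholtz_form a b k u (\<phi> (zs ! i)) =
        (\<Sum>j<?n. vec_index c j * helmholtz_form a b k (\<phi> (zs ! j)) (\<phi> (zs ! i)))"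
      unfolding u_def using that basis
      by (intro helmholtz_form_linear_combination_left[OF assms(2)]) auto
    also have "\<dots> = vec_index (?A *\<^sub>v c) i"
      using that c
      by (simp add: system_matrix_eq_gram_helmholtz_form gram_matrix_def scalar_prod_def
          mult.commute lessThan_atLeast0)
    finally show ?thesis
      using that Ac by simp
  qed
  have orth: "helmholtz_form a b k u v = 0" if v: "v \<in> fe_space a b \<T> p" for v
  proof -
    define w where "w = (\<lambda>x. \<Sum>i<?n. v (zs ! i) * \<phi> (zs ! i) x)"
    have w: "w \<in> fe_space a b \<T> p"
      unfolding w_def using basis by (intro fe_space_linear_combination) auto
    have "v z = w z" if "z \<in> nodal_points \<T> F N" for z
    proof -
      have "z \<in> set zs"
        using that assms(8) by simp
      then obtain j where "j < ?n" "zs ! j = z"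
        unfolding in_set_conv_nth by blast
      then show ?thesis
        using nodal[of j "\<lambda>i. v (zs ! i)"] by (simp add: w_def)
    qed
    then have "v x = w x" if "x \<in> {a..b}" for x
      using fe_determined_by_nodal_values[OF assms(2) _ _ assms(5) v w _ that] assms(4)
      by (auto simp: reference_nodes_def)
    then have "helmholtz_form a b k u v = helmholtz_form a b k u w"
      using assms(1) by (intro helmholtz_form_cong_right) auto
    also have "\<dots> = (\<Sum>i<?n. cnj (v (zs ! i)) * helmholtz_form a b k u (\<phi> (zs ! i)))"
      unfolding w_def using basis u
      by (intro helmholtz_form_linear_combination_right[OF assms(2)]) auto
    also have "\<dots> = 0"
      using row by simp
    finally show ?thesis .
  qed
  show "c = 0\<^sub>v ?n"
  proof (rule eq_vecI)
    fix j assume "j < dim_vec (0\<^sub>v ?n :: complex vec)"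
    then have j: "j < ?n"
      by simp
    have "zs ! j \<in> {a..b}"
      using nodal_points_subset[OF assms(2,5), of N] assms(4,8) j
      by (metis nth_mem reference_nodes_def subsetD)
    then have "u (zs ! j) = 0"
      using helmholtz_form_kernel_trivial[OF assms(1,2,9) u orth] by blast
    then show "vec_index c j = vec_index (0\<^sub>v ?n) j"
      using nodal[OF j, of "vec_index c"] j by (simp add: u_def)
  qed (use c in simp)
qed

end
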